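(* If $G$ is a tree, then $\pi_f(G)<\sqrt2$.
   Context: Two edges are nonincident if they share no endpoint. A linear ordering of $V(G)$ separates a pair of nonincident edges if both endpoints of one edge precede both endpoints of the other. $\pi_t(G)$ is the minimum length of a list of linear orderings of $V(G)$ (repetitions allowed) separating every pair of nonincident edges at least $t$ times ($0$ if there are no such pairs), and the fractional separation dimension is $\pi_f(G)=\liminf_{t\to\infty}\pi_t(G)/t$. *)

theory Defs
  imports Complex_Main "HOL-Library.Extended_Real"
begin

text \<open>A graph is given by its vertex set and its set of edges, an edge being the set of its two
  endpoints.\<close>

definition finite_simple_graph :: "'a set \<Rightarrow> 'a set set \<Rightarrow> bool" where
  "finite_simple_graph V E \<longleftrightarrow> finite V \<and> (\<forall>e\<in>E. e \<subseteq> V \<and> card e = 2)"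

definition adjacent :: "'a set set \<Rightarrow> 'a \<Rightarrow> 'a \<Rightarrow> bool" where
  "adjacent E u v \<longleftrightarrow> {u, v} \<in> E"

definition connected_graph :: "'a set \<Rightarrow> 'a set set \<Rightarrow> bool" where
  "connected_graph V E \<longleftrightarrow> V \<noteq> {} \<and> (\<forall>u\<in>V. \<forall>v\<in>V. (adjacent E)\<^sup>*\<^sup>* u v)"

text \<open>A cycle is the list of its vertices, in order and without repeating the starting point.\<close>

definition is_cycle :: "'a set set \<Rightarrow> 'a list \<Rightarrow> bool" where
  "is_cycle E c \<longleftrightarrow>
     length c \<ge> 3 \<and> distinct c \<and> successively (adjacent E) c \<and> adjacent E (last c) (hd c)"

definition is_tree :: "'a set \<Rightarrow> 'a set set \<Rightarrow> bool" where
  "is_tree V E \<longleftrightarrow> finite_simple_graph V E \<and> connected_graph V E \<and> (\<nexists>c. is_cycle E c)"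

definition nonincident :: "'a set \<Rightarrow> 'a set \<Rightarrow> bool" where
  "nonincident e f \<longleftrightarrow> e \<inter> f = {}"

text \<open>Linear orderings are reflexive relations, as in \<^const>\<open>linear_order_on\<close>; to precede is
  meant strictly, hence the removal of \<^const>\<open>Id\<close>.\<close>

definition separates :: "'a rel \<Rightarrow> 'a set \<Rightarrow> 'a set \<Rightarrow> bool" where
  "separates r e f \<longleftrightarrow> e \<times> f \<subseteq> r - Id \<or> f \<times> e \<subseteq> r - Id"

definition t_separating :: "'a set \<Rightarrow> 'a set set \<Rightarrow> nat \<Rightarrow> 'a rel list \<Rightarrow> bool" where
  "t_separating V E t L \<longleftrightarrow>
     (\<forall>r\<in>set L. linear_order_on V r) \<and>
     (\<forall>e\<in>E. \<forall>f\<in>E. nonincident e f \<longrightarrow> length (filter (\<lambda>r. separates r e f) L) \<ge> t)"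

text \<open>For a graph without nonincident edges the empty list qualifies, so the value is 0.\<close>

definition separation_dim :: "'a set \<Rightarrow> 'a set set \<Rightarrow> nat \<Rightarrow> nat" where
  "separation_dim V E t = (LEAST k. \<exists>L. length L = k \<and> t_separating V E t L)"

definition fractional_separation_dim :: "'a set \<Rightarrow> 'a set set \<Rightarrow> ereal" where
  "fractional_separation_dim V E =
     liminf (\<lambda>t. ereal (real (separation_dim V E t) / real t))"

end

theory Submission
  imports Defs "HOL-Combinatorics.Permutations"
begin

text \<open>Root the tree and consider random orderings in which every subtree is an interval. A vertex
  is placed on the same side of its parent \<open>p\<close> as \<open>p\<close> is of its own parent with
  probability \<open>\<alpha>\<close>, and siblings are sorted at random by their distance from the parent. An edge is
  then separated from an edge in a subtree hanging below it with probability \<open>\<alpha>\<close>. An edge from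
  \<open>p\<close> to a child is not separated from an edge in the subtree of another child of \<open>p\<close> only if
  both children lie on the same side and the second one is closer to \<open>p\<close>. If the sides were
  independent, the latter would happen with probability \<open>(\<alpha>\<^sup>2 + (1 - \<alpha>)\<^sup>2) / 2\<close>, and both
  separation probabilities would be \<open>1/\<surd>2\<close> for \<open>\<alpha> = 1/\<surd>2\<close>. Choosing sides and distances by one
  random permutation of \<open>n\<close> ranks, the first \<open>k\<close> of which mean the same side, correlates the
  sides of siblings negatively, and with \<open>2k\<^sup>2 = n\<^sup>2 + 1\<close> both probabilities exceed
  \<open>1/\<surd>2\<close>. Different levels of the tree may be fully correlated, so a single permutation
  suffices.\<close>

section \<open>Reducing the liminf to one list of orderings\<close>

lemma t_separating_concat_replicate:
  assumes "t_separating V E t L"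
  shows "t_separating V E (s * t) (concat (replicate s L))"
proof -
  have len: "length (filter P (concat (replicate s L))) = s * length (filter P L)" for P
    by (induction s) auto
  show ?thesis
    using assms unfolding t_separating_def len by (auto intro!: mult_le_mono2)
qed

text \<open>Concatenating copies of \<open>L\<close> bounds the quotient by
  \<open>length L / t\<close> at every positive multiple of \<open>t\<close>, and the liminf over a
  subsequence is at least the full liminf.\<close>

lemma fractional_separation_dim_le:
  assumes L: "t_separating V E t L" and t: "t > 0"
  shows "fractional_separation_dim V E \<le> ereal (real (length L) / real t)"
proof -
  let ?X = "\<lambda>t. ereal (real (separation_dim V E t) / real t)"
  define \<rho> where "\<rho> s = Suc s * t" for s
  have mono: "strict_mono \<rho>"
    using t by (auto simp: strict_mono_def \<rho>_def)
  have bound: "(?X \<circ> \<rho>) s \<le> ereal (real (length L) / real t)" for s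
  proof -
    have len: "length (concat (replicate m L)) = m * length L" for m
      by (induction m) auto
    have "separation_dim V E (\<rho> s) \<le> Suc s * length L"
      unfolding separation_dim_def \<rho>_def
      using t_separating_concat_replicate[OF L, of "Suc s"] len[of "Suc s"]
      by (intro Least_le) blast
    then have "real (separation_dim V E (\<rho> s)) \<le> real (Suc s) * real (length L)"
      by (metis of_nat_le_iff of_nat_mult)
    then have "real (separation_dim V E (\<rho> s)) / real (\<rho> s)
        \<le> (real (Suc s) * real (length L)) / (real (Suc s) * real t)"
      unfolding \<rho>_def of_nat_mult by (intro divide_right_mono) auto
    also have "\<dots> = real (length L) / real t"
      by (subst mult_divide_mult_cancel_left) auto
    finally show ?thesis by simp
  qed
  have "liminf ?X \<le> liminf (?X \<circ> \<rho>)"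
    by (rule liminf_subseq_mono[OF mono])
  also have "\<dots> \<le> liminf (\<lambda>_. ereal (real (length L) / real t))"
    by (intro Liminf_mono always_eventually allI bound)
  also have "\<dots> = ereal (real (length L) / real t)"
    by (simp add: Liminf_const)
  finally show ?thesis
    unfolding fractional_separation_dim_def .
qed

section \<open>Counting permutations\<close>

text \<open>One transposition sends \<open>i\<close> to \<open>i'\<close>, a second one sends the
  image of \<open>j\<close> to \<open>j'\<close>. The second fixes \<open>i'\<close>, since neither
  of the points it swaps is \<open>i'\<close>.\<close>

lemma permutes_double_transitive:
  assumes "i \<in> A" "j \<in> A" "i \<noteq> j" "i' \<in> A" "j' \<in> A" "i' \<noteq> j'"
  obtains \<tau> where "\<tau> permutes A" "\<tau> i = i'" "\<tau> j = j'"
proof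
  let ?a = "transpose i i'"
  let ?b = "transpose (?a j) j'"
  have a: "?a permutes A" using assms by (intro permutes_swap_id)
  then have "?a j \<in> A" using assms permutes_in_image by metis
  then have "?b permutes A" using assms by (intro permutes_swap_id)
  with a show "(?b \<circ> ?a) permutes A" by (rule permutes_compose)
  have "?a j \<noteq> i'" using assms by (metis transpose_apply_first transpose_eq_imp_eq)
  then show "(?b \<circ> ?a) i = i'" using assms by (simp add: transpose_apply_other)
  show "(?b \<circ> ?a) j = j'" by simp
qed

text \<open>By double transitivity the count does not depend on \<open>i\<close> and \<open>j\<close>, so it can be averaged
  over all pairs of distinct indices.\<close>

lemma card_permutes_pair_in:
  assumes A: "finite A" and ij: "i \<in> A" "j \<in> A" "i \<noteq> j"
    and S: "S \<subseteq> A \<times> A - Id"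
  shows "card {\<sigma>. \<sigma> permutes A \<and> (\<sigma> i, \<sigma> j) \<in> S} * (card A * (card A - 1))
    = fact (card A) * card S"
proof -
  define P where "P = {\<sigma>. \<sigma> permutes A}"
  define D where "D = A \<times> A - Id"
  define N where "N q = card {\<sigma>\<in>P. (\<sigma> (fst q), \<sigma> (snd q)) \<in> S}" for q
  have finP: "finite P" and cardP: "card P = fact (card A)"
    unfolding P_def using A by (auto simp: finite_permutations card_permutations)
  have finD: "finite D" unfolding D_def using A by auto
  have D_eq: "D = A \<times> A - (\<lambda>x. (x, x)) ` A" unfolding D_def by auto
  have cardD: "card D = card A * (card A - 1)"
    unfolding D_eq using A by (subst card_Diff_subset)
      (auto simp: card_image inj_on_def card_cartesian_product algebra_simps)
  have const: "N q = N (i, j)" if q_in: "q \<in> D" for q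
  proof -
    obtain i' j' where q: "q = (i', j')" "i' \<in> A" "j' \<in> A" "i' \<noteq> j'"
      using q_in unfolding D_def by auto
    obtain \<tau> where \<tau>: "\<tau> permutes A" "\<tau> i = i'" "\<tau> j = j'"
      using permutes_double_transitive[OF ij q(2-4)] .
    have "bij_betw (\<lambda>\<sigma>. \<sigma> \<circ> \<tau>) {\<sigma>\<in>P. (\<sigma> i', \<sigma> j') \<in> S} {\<sigma>\<in>P. (\<sigma> i, \<sigma> j) \<in> S}"
    proof (rule bij_betw_byWitness[where f' = "\<lambda>\<sigma>. \<sigma> \<circ> inv \<tau>"])
      show "\<forall>\<sigma>\<in>{\<sigma>\<in>P. (\<sigma> i', \<sigma> j') \<in> S}. \<sigma> \<circ> \<tau> \<circ> inv \<tau> = \<sigma>"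
        using permutes_inv_o(1)[OF \<tau>(1)] by (auto simp: o_assoc[symmetric])
      show "\<forall>\<sigma>\<in>{\<sigma>\<in>P. (\<sigma> i, \<sigma> j) \<in> S}. \<sigma> \<circ> inv \<tau> \<circ> \<tau> = \<sigma>"
        using permutes_inv_o(2)[OF \<tau>(1)] by (auto simp: o_assoc[symmetric])
      show "(\<lambda>\<sigma>. \<sigma> \<circ> \<tau>) ` {\<sigma>\<in>P. (\<sigma> i', \<sigma> j') \<in> S} \<subseteq> {\<sigma>\<in>P. (\<sigma> i, \<sigma> j) \<in> S}"
        using \<tau> by (auto simp: P_def intro: permutes_compose)
      have "inv \<tau> i' = i" "inv \<tau> j' = j"
        using \<tau> by (metis permutes_inverses(2))+
      then show "(\<lambda>\<sigma>. \<sigma> \<circ> inv \<tau>) ` {\<sigma>\<in>P. (\<sigma> i, \<sigma> j) \<in> S} \<subseteq> {\<sigma>\<in>P. (\<sigma> i', \<sigma> j') \<in> S}"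
        using permutes_inv[OF \<tau>(1)] by (auto simp: P_def intro: permutes_compose)
    qed
    then show ?thesis
      unfolding N_def q by (simp add: bij_betw_same_card)
  qed
  \<comment> \<open>A permutation of \<open>A\<close> acts bijectively on \<open>D\<close>, so
    \<open>S\<close> and its preimage have equal size. This evaluates the double sum in the other
    order.\<close>
  have inner: "card {q\<in>D. (\<sigma> (fst q), \<sigma> (snd q)) \<in> S} = card S" if "\<sigma> \<in> P" for \<sigma>
  proof -
    have \<sigma>: "\<sigma> permutes A" using that unfolding P_def by simp
    have "bij_betw (map_prod \<sigma> \<sigma>) {q\<in>D. (\<sigma> (fst q), \<sigma> (snd q)) \<in> S} S"
    proof (rule bij_betw_byWitness[where f' = "map_prod (inv \<sigma>) (inv \<sigma>)"])
      show "map_prod (inv \<sigma>) (inv \<sigma>) ` S \<subseteq> {q\<in>D. (\<sigma> (fst q), \<sigma> (snd q)) \<in> S}"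
        using S permutes_in_image[OF permutes_inv[OF \<sigma>]] permutes_inverses(1)[OF \<sigma>]
        by (auto simp: D_def) (metis IdI S DiffD2 subsetD)
    qed (use permutes_inverses[OF \<sigma>] in auto)
    then show ?thesis by (rule bij_betw_same_card)
  qed
  have "N (i, j) * card D = (\<Sum>q\<in>D. N q)"
    using const by simp
  also have "\<dots> = (\<Sum>q\<in>D. \<Sum>\<sigma>\<in>P. of_bool ((\<sigma> (fst q), \<sigma> (snd q)) \<in> S))"
    unfolding N_def using finP by (simp add: sum.If_cases of_bool_def Int_def)
  also have "\<dots> = (\<Sum>\<sigma>\<in>P. \<Sum>q\<in>D. of_bool ((\<sigma> (fst q), \<sigma> (snd q)) \<in> S))"
    by (rule sum.swap)
  also have "\<dots> = (\<Sum>\<sigma>\<in>P. card {q\<in>D. (\<sigma> (fst q), \<sigma> (snd q)) \<in> S})"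
    using finD by (simp add: sum.If_cases of_bool_def Int_def)
  also have "\<dots> = fact (card A) * card S"
    using inner cardP by simp
  finally show ?thesis
    by (simp add: N_def cardD P_def)
qed

text \<open>Both entries lie below \<open>k\<close> or both lie in \<open>{k..<n}\<close>; each case
  contributes a triangular number.\<close>

lemma card_same_side_inversions:
  assumes "k \<le> n"
  shows "2 * card {(a, b). a < n \<and> b < a \<and> (a < k \<longleftrightarrow> b < k)}
    = k * (k - 1) + (n - k) * (n - k - 1)"
proof -
  have eq: "{(a, b). a < n \<and> b < a \<and> (a < k \<longleftrightarrow> b < k)}
      = (SIGMA a:{..<k}. {..<a}) \<union> (SIGMA a:{k..<n}. {k..<a})"
    using assms by auto
  have "card \<dots> = (\<Sum>a<k. a) + (\<Sum>a\<in>{k..<n}. a - k)"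
    by (subst card_Un_disjoint) auto
  also have "(\<Sum>a\<in>{k..<n}. a - k) = (\<Sum>a<n - k. a)"
    by (rule sum.reindex_bij_witness[of _ "\<lambda>a. a + k" "\<lambda>a. a - k"]) auto
  finally have "card {(a, b). a < n \<and> b < a \<and> (a < k \<longleftrightarrow> b < k)} = (\<Sum>a<k. a) + (\<Sum>a<n - k. a)"
    unfolding eq .
  moreover have "2 * (\<Sum>a<m. a) = m * (m - 1)" for m :: nat
  proof (induction m)
    case (Suc m) then show ?case by (cases m) auto
  qed simp
  ultimately show ?thesis by (simp add: add_mult_distrib2)
qed

text \<open>The fractions \<open>k/n\<close> approximate \<open>1/\<surd>2\<close> from above closely enough that
  both events that matter below have probability more than \<open>1/\<surd>2\<close>.\<close>

lemma Pell_solution_ge: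
  obtains k n :: nat where "N \<le> n" "3 \<le> n" "k \<le> n" "2 * k\<^sup>2 = n\<^sup>2 + 1"
proof -
  have "\<exists>k n :: nat. N \<le> n \<and> 3 \<le> n \<and> k \<le> n \<and> 2 * k\<^sup>2 = n\<^sup>2 + 1"
  proof (induction N)
    case 0
    have "2 * (5::nat)\<^sup>2 = 7\<^sup>2 + 1" by simp
    then show ?case by (intro exI[of _ 5] exI[of _ 7]) simp
  next
    case (Suc N)
    then obtain k n :: nat where kn: "N \<le> n" "3 \<le> n" "k \<le> n" "2 * k\<^sup>2 = n\<^sup>2 + 1" by blast
    \<comment> \<open>The next solution comes from multiplying n + k sqrt 2, of norm -1, by the unit
      3 + 2 sqrt 2 of norm 1.\<close>
    then have "2 * (2 * n + 3 * k)\<^sup>2 = (3 * n + 4 * k)\<^sup>2 + 1"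
      by (simp add: power2_eq_square algebra_simps)
    with kn show ?case
      by (intro exI[of _ "2 * n + 3 * k"] exI[of _ "3 * n + 4 * k"]) auto
  qed
  with that show ?thesis by blast
qed

lemma Pell_imp_sqrt2_lt:
  fixes k n :: nat
  assumes "2 * k\<^sup>2 = n\<^sup>2 + 1"
  shows "real n < sqrt 2 * real k"
proof -
  have "2 * (real k)\<^sup>2 = (real n)\<^sup>2 + 1"
    using arg_cong[OF assms, of real] by simp
  then have "(real n)\<^sup>2 < (sqrt 2 * real k)\<^sup>2"
    by (simp add: power_mult_distrib)
  then show ?thesis
    by (rule power_less_imp_less_base) simp
qed

text \<open>This is the count for pairs with a dummy second index \<open>j\<close>, whose value is
  only required to differ from that of \<open>i\<close>.\<close>

lemma card_permutes_below:
  fixes n k :: nat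
  assumes "k \<le> n" "2 \<le> n" "i < n"
  shows "real (card {\<sigma>. \<sigma> permutes {..<n} \<and> \<sigma> i < k}) * real n = fact n * real k"
proof -
  obtain j where j: "j < n" "i \<noteq> j"
    using assms by (metis Suc_1 Suc_le_lessD less_trans zero_less_one zero_neq_one One_nat_def)
  define S where "S = (SIGMA a:{..<k}. {..<n} - {a})"
  have "S \<subseteq> {..<n} \<times> {..<n} - Id" using assms by (auto simp: S_def)
  from card_permutes_pair_in[OF _ _ _ j(2) this] j assms
  have "card {\<sigma>. \<sigma> permutes {..<n} \<and> (\<sigma> i, \<sigma> j) \<in> S} * (n * (n - 1)) = fact n * card S"
    by simp
  moreover have "card S = k * (n - 1)"
    using assms by (simp add: S_def)
  moreover have "{\<sigma>. \<sigma> permutes {..<n} \<and> (\<sigma> i, \<sigma> j) \<in> S} = {\<sigma>. \<sigma> permutes {..<n} \<and> \<sigma> i < k}"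
  proof -
    have "\<sigma> j < n \<and> \<sigma> i \<noteq> \<sigma> j" if "\<sigma> permutes {..<n}" for \<sigma>
      using that j permutes_in_image[OF that, of j] permutes_inj[OF that] by (auto dest: injD)
    then show ?thesis by (auto simp: S_def) metis
  qed
  ultimately have "card {\<sigma>. \<sigma> permutes {..<n} \<and> \<sigma> i < k} * n * (n - 1) = fact n * k * (n - 1)"
    by (simp add: mult.assoc)
  then have eq: "card {\<sigma>. \<sigma> permutes {..<n} \<and> \<sigma> i < k} * n = fact n * k"
    using assms by simp
  show ?thesis
    using arg_cong[OF eq, of real] by (simp only: of_nat_mult of_nat_fact)
qed

lemma card_permutes_below_gt:
  fixes n k :: nat
  assumes "k \<le> n" "3 \<le> n" "2 * k\<^sup>2 = n\<^sup>2 + 1" "i < n"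
  shows "fact n < sqrt 2 * real (card {\<sigma>. \<sigma> permutes {..<n} \<and> \<sigma> i < k})"
proof -
  let ?c = "real (card {\<sigma>. \<sigma> permutes {..<n} \<and> \<sigma> i < k})"
  have "fact n * real n < fact n * (sqrt 2 * real k)"
    using Pell_imp_sqrt2_lt[OF assms(3)] by (intro mult_strict_left_mono) auto
  also have "\<dots> = sqrt 2 * (fact n * real k)" by simp
  also have "\<dots> = (sqrt 2 * ?c) * real n"
    using card_permutes_below[of k n i] assms by simp
  finally show ?thesis
    by (rule mult_right_less_imp_less) simp
qed

text \<open>The excluded event has probability \<open>card S / (n * (n - 1))\<close>. Eliminating
  the square of \<open>k\<close> by Pell's equation leaves (2nk - n - 1) / (2n(n - 1)) for its
  complement.\<close>

lemma card_permutes_not_same_side_inversion_gt: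
  fixes n k :: nat
  assumes kn: "k \<le> n" "3 \<le> n" and pell: "2 * k\<^sup>2 = n\<^sup>2 + 1" and ij: "i < n" "j < n" "i \<noteq> j"
  shows "fact n < sqrt 2 * real (card {\<sigma>. \<sigma> permutes {..<n} \<and>
    \<not> (\<sigma> j < \<sigma> i \<and> (\<sigma> i < k \<longleftrightarrow> \<sigma> j < k))})" (is "_ < _ * real (card ?G)")
proof -
  define S where "S = {(a, b). a < n \<and> b < a \<and> (a < k \<longleftrightarrow> b < k)}"
  define P where "P = {\<sigma>. \<sigma> permutes {..<n}}"
  define B where "B = {\<sigma>\<in>P. (\<sigma> i, \<sigma> j) \<in> S}"
  have finP: "finite P" and cardP: "card P = fact n"
    unfolding P_def by (auto simp: finite_permutations card_permutations)
  have G: "?G = P - B"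
  proof -
    have "\<sigma> i < n" if "\<sigma> permutes {..<n}" for \<sigma>
      using ij permutes_in_image[OF that, of i] by simp
    then show ?thesis by (auto simp: P_def B_def S_def)
  qed
  have "B \<subseteq> P" by (auto simp: B_def)
  then have "card B + card ?G = fact n"
    unfolding G using finP cardP card_mono[of P B] by (simp add: card_Diff_subset finite_subset)
  from arg_cong[OF this, of real] have sum: "real (card B) + real (card ?G) = fact n"
    by (simp only: of_nat_add of_nat_fact)
  have "S \<subseteq> {..<n} \<times> {..<n} - Id" by (auto simp: S_def)
  then have "card B * (n * (n - 1)) = fact n * card S"
    using card_permutes_pair_in[of "{..<n}" i j S] ij by (simp add: P_def B_def)
  from arg_cong[OF this, of real]
  have B: "real (card B) * (real n * (real n - 1)) = fact n * real (card S)"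
    using kn by (simp add: of_nat_diff)
  have S: "2 * real (card S) = real k * (real k - 1) + (real n - real k) * (real n - real k - 1)"
  proof -
    have step: "real (m * (m - 1)) = real m * (real m - 1)" for m
      by (cases m) (auto simp: algebra_simps)
    have "2 * real (card S) = real (k * (k - 1)) + real ((n - k) * (n - k - 1))"
      using arg_cong[OF card_same_side_inversions[OF kn(1)], of real] by (simp add: S_def)
    then show ?thesis
      unfolding step using kn by (simp add: of_nat_diff)
  qed
  have rpell: "2 * (real k * real k) = real n * real n + 1"
    using arg_cong[OF pell, of real] by (simp add: power2_eq_square)
  have "2 * (real (card B) * (real n * (real n - 1))) = fact n * (2 * real (card S))"
    using B by simp
  also have "2 * real (card S) = 2 * (real n * (real n - 1)) - (2 * (real n * real k) - real n - 1)"
    using S rpell by (simp add: algebra_simps)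
  finally have card_B: "2 * (real (card B) * (real n * (real n - 1)))
      = fact n * (2 * (real n * (real n - 1)) - (2 * (real n * real k) - real n - 1))" .
  have card_G: "2 * (real (card ?G) * (real n * (real n - 1)))
      = fact n * (2 * (real n * real k) - real n - 1)"
  proof -
    have "real (card ?G) = fact n - real (card B)" using sum by simp
    then show ?thesis using card_B by (simp only: left_diff_distrib) (simp add: algebra_simps)
  qed
  have "2 * (real n * (real n - 1)) < sqrt 2 * (2 * (real n * real k) - real n - 1)"
  proof -
    have "sqrt 2 < 1.5" by (rule real_less_lsqrt) (auto simp: power2_eq_square)
    then have "sqrt 2 * (real n + 1) \<le> 1.5 * (real n + 1)"
      by (intro mult_right_mono) auto
    \<comment> \<open>This holds exactly for \<open>3 <= n\<close>, given the estimate 1.5 for sqrt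
      2.\<close>
    also have "\<dots> \<le> 2 * real n" using kn by simp
    finally have "sqrt 2 * (real n + 1) \<le> 2 * real n" .
    moreover have "2 * (real n * real n) < 2 * (real n * (sqrt 2 * real k))"
      using Pell_imp_sqrt2_lt[OF pell] kn by simp
    ultimately show ?thesis by (simp add: algebra_simps)
  qed
  then have "fact n * (2 * (real n * (real n - 1)))
      < fact n * (sqrt 2 * (2 * (real n * real k) - real n - 1))"
    by (intro mult_strict_left_mono) auto
  also have "\<dots> = sqrt 2 * (2 * (real (card ?G) * (real n * (real n - 1))))"
    unfolding card_G by simp
  finally have "fact n * (2 * (real n * (real n - 1)))
      < (sqrt 2 * real (card ?G)) * (2 * (real n * (real n - 1)))"
    by (simp only: mult_ac)
  then show ?thesis
    by (rule mult_right_less_imp_less) (use kn in simp)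
qed

section \<open>Orderings of rooted trees\<close>

text \<open>Since \<open>depth\<close> drops by one at each step to the parent, iterating
  \<open>par\<close> from any vertex ends at \<open>root\<close>. The value \<open>par root\<close>
  is arbitrary.\<close>

locale rooted_tree =
  fixes V :: "'a set" and root :: 'a and par :: "'a \<Rightarrow> 'a" and depth :: "'a \<Rightarrow> nat"
  assumes root_in: "root \<in> V"
    and depth_root: "depth root = 0"
    and par_in: "v \<in> V \<Longrightarrow> v \<noteq> root \<Longrightarrow> par v \<in> V"
    and depth_par: "v \<in> V \<Longrightarrow> v \<noteq> root \<Longrightarrow> depth v = Suc (depth (par v))"
begin

section \<open>Descendants and branching\<close>

definition child :: "'a \<Rightarrow> 'a \<Rightarrow> bool" where
  "child p v \<longleftrightarrow> v \<in> V \<and> v \<noteq> root \<and> par v = p"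

definition below :: "'a \<Rightarrow> 'a \<Rightarrow> bool" where
  "below = child\<^sup>*\<^sup>*"

lemma below_refl: "below v v"
  by (simp add: below_def)

lemma below_child: "below a p \<Longrightarrow> child p v \<Longrightarrow> below a v"
  unfolding below_def by (rule rtranclp.rtrancl_into_rtrancl)

lemma below_in_V: "below a v \<Longrightarrow> a \<in> V \<Longrightarrow> v \<in> V"
  unfolding below_def by (induction rule: rtranclp_induct) (auto simp: child_def)

lemma child_in_V: "child p v \<Longrightarrow> p \<in> V \<and> v \<in> V"
  by (auto simp: child_def par_in)

lemma below_par:
  assumes "below a v" "child p v" "a \<noteq> v"
  shows "below a p"
  using assms unfolding below_def by (metis child_def rtranclp.cases)

lemma below_cases_child:
  assumes "below a v" "a \<noteq> v"
  obtains c where "child a c" "below c v"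
  using assms unfolding below_def by (metis converse_rtranclpE)

lemma below_root:
  assumes "v \<in> V"
  shows "below root v"
  using assms
proof (induction "depth v" arbitrary: v)
  case 0
  then show ?case using depth_par below_refl by (metis nat.distinct(1))
next
  case (Suc d)
  then have "v \<noteq> root" using depth_root by auto
  with Suc have "below root (par v)" "child (par v) v"
    using depth_par par_in by (auto simp: child_def)
  then show ?case by (rule below_child)
qed

text \<open>Walk from the root to \<open>v\<close>. The walk starts at an ancestor of
  \<open>u\<close>; when it leaves an ancestor \<open>p\<close> of \<open>u\<close> with
  \<open>p\<close> different from \<open>u\<close>, its next vertex is either the child of
  \<open>p\<close> towards \<open>u\<close> or a sibling of that child, and in the latter case the
  two branches stay apart.\<close>

lemma below_trichotomy:
  assumes u: "u \<in> V" and v: "v \<in> V"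
  obtains "below u v" | "below v u"
  | p a b where "child p a" "child p b" "a \<noteq> b" "below a u" "below b v"
proof -
  have "below u v \<or> below v u \<or>
      (\<exists>p a b. child p a \<and> child p b \<and> a \<noteq> b \<and> below a u \<and> below b v)"
    using below_root[OF v, unfolded below_def]
  proof (induction rule: rtranclp_induct)
    case base
    then show ?case using below_root[OF u] by simp
  next
    case (step p v)
    from step.IH consider "below u p" | "below p u"
      | "\<exists>p' a b. child p' a \<and> child p' b \<and> a \<noteq> b \<and> below a u \<and> below b p" by blast
    then show ?case
    proof cases
      case 1
      then show ?thesis using below_child step by blast
    next
      case 2
      show ?thesis
      proof (cases "p = u")
        case True
        then show ?thesis using below_child[OF below_refl] step by blast
      next
        case False
        then obtain c where "child p c" "below c u" using below_cases_child 2 by blast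
        then show ?thesis using step below_refl by metis
      qed
    next
      case 3
      then show ?thesis using below_child step by blast
    qed
  qed
  with that show ?thesis by blast
qed

text \<open>With \<open>m = depth v\<close> this folds \<open>f\<close> down the path from the root
  to \<open>v\<close>, where \<open>a\<close> is the value at the root. The recursion is on
  \<open>m\<close> because vertices have no structure to recurse on.\<close>

primrec along :: "('a \<Rightarrow> 'b \<Rightarrow> 'b) \<Rightarrow> 'b \<Rightarrow> nat \<Rightarrow> 'a \<Rightarrow> 'b" where
  "along f a 0 v = a"
| "along f a (Suc m) v = f v (along f a m (par v))"

text \<open>The sign \<open>side\<close> records on which side of its parent a vertex lies; it is the sign of the
  parent exactly if \<open>g v < k\<close>, and \<open>g\<close> also ranks siblings by their distance from the parent.
  The powers of \<open>2n + 1\<close> make the subtrees of siblings occupy disjoint intervals.\<close>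

definition side :: "nat \<Rightarrow> ('a \<Rightarrow> nat) \<Rightarrow> 'a \<Rightarrow> real" where
  "side k g v = along (\<lambda>v s. if g v < k then s else - s) 1 (depth v) v"

definition scale :: "nat \<Rightarrow> 'a \<Rightarrow> real" where
  "scale n v = 1 / (2 * real n + 1) ^ depth v"

text \<open>The summand 1 in the offset keeps the block of a child clear of the parent even when the
  child has rank 0.\<close>

definition pos :: "nat \<Rightarrow> nat \<Rightarrow> ('a \<Rightarrow> nat) \<Rightarrow> 'a \<Rightarrow> real" where
  "pos n k g v = along (\<lambda>v x. x + side k g v * (1 + real (g v)) * scale n v) 0 (depth v) v"

definition layout :: "nat \<Rightarrow> nat \<Rightarrow> ('a \<Rightarrow> nat) \<Rightarrow> 'a rel" where
  "layout n k g = {(x, y). x \<in> V \<and> y \<in> V \<and> pos n k g x \<le> pos n k g y}"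

lemma side_cases: "side k g v = 1 \<or> side k g v = -1"
proof -
  have "along (\<lambda>v s. if g v < k then s else - s) (1::real) m v \<in> {1, -1}" for m
    by (induction m arbitrary: v) auto
  then show ?thesis unfolding side_def by auto
qed

lemma side_child: "child p v \<Longrightarrow> side k g v = (if g v < k then side k g p else - side k g p)"
  unfolding side_def child_def by (auto simp: depth_par)

lemma pos_child:
  "child p v \<Longrightarrow> pos n k g v = pos n k g p + side k g v * (1 + real (g v)) * scale n v"
  unfolding pos_def child_def by (auto simp: depth_par)

lemma scale_pos: "scale n v > 0"
  unfolding scale_def by (intro divide_pos_pos zero_less_power) linarith+

lemma scale_child: "child p v \<Longrightarrow> scale n p = (2 * real n + 1) * scale n v"
  unfolding scale_def child_def by (auto simp: depth_par add_nonneg_eq_0_iff)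

lemma scale_siblings: "child p a \<Longrightarrow> child p b \<Longrightarrow> scale n a = scale n b"
  unfolding scale_def child_def by (auto simp: depth_par)

section \<open>Subtrees as disjoint intervals\<close>

context
  fixes n k :: nat and g :: "'a \<Rightarrow> nat"
  assumes g_less: "v \<in> V \<Longrightarrow> g v < n"
begin

text \<open>A step from \<open>p\<close> to a child \<open>v\<close> moves by at most
  \<open>n * scale n v\<close>, which equals \<open>(scale n p - scale n v) / 2\<close> because the
  scales have ratio \<open>2 * n + 1\<close>. These bounds telescope along the path.\<close>

lemma below_pos:
  assumes "below c v"
  shows "\<bar>pos n k g v - pos n k g c\<bar> < scale n c / 2"
proof -
  have "\<bar>pos n k g v - pos n k g c\<bar> \<le> (scale n c - scale n v) / 2"
    using assms unfolding below_def
  proof (induction rule: rtranclp_induct)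
    case base
    then show ?case by simp
  next
    case (step p v)
    have "real (g v) + 1 \<le> real n"
      using g_less step(2) by (fastforce simp: child_def)
    then have "(1 + real (g v)) * scale n v \<le> real n * scale n v"
      using scale_pos[of n v] by (intro mult_right_mono) auto
    moreover have "\<bar>pos n k g v - pos n k g p\<bar> = (1 + real (g v)) * scale n v"
      using side_cases[of k g v] scale_pos[of n v]
      by (auto simp: pos_child[OF step(2)] abs_mult)
    ultimately have "\<bar>pos n k g v - pos n k g p\<bar> \<le> (scale n p - scale n v) / 2"
      using scale_child[OF step(2), of n] by (simp add: algebra_simps)
    then show ?case
      using step(3) abs_triangle_ineq[of "pos n k g v - pos n k g p" "pos n k g p - pos n k g c"]
      by simp
  qed
  also have "\<dots> < scale n c / 2" using scale_pos[of n v] by simp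
  finally show ?thesis .
qed

lemma pos_block_gt_parent:
  assumes "child p a" "below a u" "side k g a = 1"
  shows "pos n k g p < pos n k g u"
proof -
  have "pos n k g a \<ge> pos n k g p + scale n a"
    using assms scale_pos[of n a] by (simp add: pos_child algebra_simps)
  with below_pos[OF assms(2)] scale_pos[of n a] show ?thesis by linarith
qed

lemma pos_block_lt_parent:
  assumes "child p a" "below a u" "side k g a = -1"
  shows "pos n k g u < pos n k g p"
proof -
  have "pos n k g a \<le> pos n k g p - scale n a"
    using assms scale_pos[of n a] by (simp add: pos_child algebra_simps)
  with below_pos[OF assms(2)] scale_pos[of n a] show ?thesis by linarith
qed

text \<open>The signed offsets are integers, so a strict inequality leaves a gap of at least
  \<open>scale n a\<close> between \<open>a\<close> and \<open>b\<close>, while each block has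
  radius less than half of that.\<close>

lemma pos_sibling_blocks_less:
  assumes ab: "child p a" "child p b"
    and less: "side k g a * (1 + real (g a)) < side k g b * (1 + real (g b))"
    and uv: "below a u" "below b v"
  shows "pos n k g u < pos n k g v"
proof -
  have "side k g a * (1 + real (g a)) + 1 \<le> side k g b * (1 + real (g b))"
    using less side_cases[of k g a] side_cases[of k g b] by auto
  then have "(side k g a * (1 + real (g a)) + 1) * scale n a
      \<le> side k g b * (1 + real (g b)) * scale n a"
    using scale_pos[of n a] by (intro mult_right_mono) auto
  then have "pos n k g a + scale n a \<le> pos n k g b"
    using scale_siblings[OF ab, of n] by (simp add: pos_child[OF ab(1)] pos_child[OF ab(2)] algebra_simps)
  with below_pos[OF uv(1)] below_pos[OF uv(2)] scale_siblings[OF ab, of n] show ?thesis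
    by linarith
qed

lemma separates_layoutI:
  assumes "e \<subseteq> V" "f \<subseteq> V"
    and "(\<forall>x\<in>e. \<forall>y\<in>f. pos n k g x < pos n k g y) \<or> (\<forall>x\<in>e. \<forall>y\<in>f. pos n k g y < pos n k g x)"
  shows "separates (layout n k g) e f"
proof -
  have *: "A \<times> B \<subseteq> layout n k g - Id"
    if "A \<subseteq> V" "B \<subseteq> V" "\<forall>x\<in>A. \<forall>y\<in>B. pos n k g x < pos n k g y" for A B
    using that by (auto simp: layout_def intro: less_imp_le)
  from assms(3) show ?thesis
    unfolding separates_def using *[OF assms(1,2)] *[OF assms(2,1)] by blast
qed

section \<open>Separation under injective ranks\<close>

context
  assumes g_inj: "inj_on g V"
begin

lemma sibling_offsets_distinct:
  assumes "child p a" "child p b" "a \<noteq> b"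
  shows "side k g a * (1 + real (g a)) \<noteq> side k g b * (1 + real (g b))"
proof -
  have "g a \<noteq> g b" using g_inj assms by (auto simp: child_def dest: inj_onD)
  then show ?thesis using side_cases[of k g a] side_cases[of k g b] by auto
qed

text \<open>This gives antisymmetry of \<open>layout\<close>. A proper descendant lies strictly to
  one side of its ancestor, and the blocks of distinct siblings are disjoint.\<close>

lemma pos_inj: "inj_on (pos n k g) V"
proof (rule inj_onI, rule ccontr)
  have neq: "pos n k g u \<noteq> pos n k g v" if uv: "below u v" "u \<noteq> v" for u v
  proof -
    obtain c where "child u c" "below c v" using below_cases_child[OF uv] .
    then show ?thesis
      using side_cases[of k g c] pos_block_gt_parent pos_block_lt_parent by fastforce
  qed
  fix u v assume uv: "u \<in> V" "v \<in> V" "pos n k g u = pos n k g v" "u \<noteq> v"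
  from uv(1,2) show False
  proof (cases rule: below_trichotomy)
    case (3 p a b)
    then show False
      using uv(3) sibling_offsets_distinct[of p a b] pos_sibling_blocks_less[of p a b u v]
        pos_sibling_blocks_less[of p b a v u] by linarith
  qed (use neq uv in metis)+
qed

lemma linear_order_layout: "linear_order_on V (layout n k g)"
  using pos_inj unfolding layout_def linear_order_on_def partial_order_on_def preorder_on_def
  by (auto simp: refl_on_def trans_def antisym_def total_on_def inj_on_def)

lemma separates_sibling_blocks:
  assumes ab: "child p a" "child p b" "a \<noteq> b"
    and ef: "\<And>x. x \<in> e \<Longrightarrow> below a x" "\<And>y. y \<in> f \<Longrightarrow> below b y"
  shows "separates (layout n k g) e f"
proof (rule separates_layoutI)
  show "e \<subseteq> V" "f \<subseteq> V"
    using ef below_in_V child_in_V ab(1,2) by blast+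
  show "(\<forall>x\<in>e. \<forall>y\<in>f. pos n k g x < pos n k g y) \<or> (\<forall>x\<in>e. \<forall>y\<in>f. pos n k g y < pos n k g x)"
    using sibling_offsets_distinct[OF ab] pos_sibling_blocks_less[OF ab(1,2)]
      pos_sibling_blocks_less[OF ab(2,1)] ef by (meson linorder_neq_iff)
qed

text \<open>If \<open>c\<close> and \<open>w\<close> lie on opposite sides of \<open>p\<close>, then
  \<open>p\<close> and \<open>c\<close> are both on the near side of the block of \<open>w\<close>.
  If they lie on the same side, \<open>good\<close> makes \<open>c\<close> the closer one, so the
  block of \<open>w\<close> lies beyond both \<open>p\<close> and \<open>c\<close>.\<close>

lemma separates_edge_sibling_block:
  assumes cw: "child p c" "child p w" "c \<noteq> w"
    and good: "\<not> (g w < g c \<and> (g c < k \<longleftrightarrow> g w < k))"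
    and f: "\<And>y. y \<in> f \<Longrightarrow> below w y"
  shows "separates (layout n k g) {p, c} f"
proof (rule separates_layoutI)
  show "{p, c} \<subseteq> V" "f \<subseteq> V"
    using f below_in_V child_in_V cw(1,2) by blast+
  have neq: "g c \<noteq> g w" using g_inj cw by (auto simp: child_def dest: inj_onD)
  have same: "g c < g w" if "side k g c = side k g w"
    using that good neq side_child[OF cw(1), of k g] side_child[OF cw(2), of k g]
      side_cases[of k g p] by (auto split: if_splits)
  from side_cases[of k g w]
  show "(\<forall>x\<in>{p, c}. \<forall>y\<in>f. pos n k g x < pos n k g y) \<or>
      (\<forall>x\<in>{p, c}. \<forall>y\<in>f. pos n k g y < pos n k g x)"
  proof
    assume w: "side k g w = 1"
    then have "side k g c * (1 + real (g c)) < side k g w * (1 + real (g w))"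
      using side_cases[of k g c] same by auto
    then show ?thesis
      using pos_block_gt_parent[OF cw(2) _ w] pos_sibling_blocks_less[OF cw(1,2) _ below_refl] f
      by auto
  next
    assume w: "side k g w = -1"
    then have "side k g w * (1 + real (g w)) < side k g c * (1 + real (g c))"
      using side_cases[of k g c] same by auto
    then show ?thesis
      using pos_block_lt_parent[OF cw(2) _ w] pos_sibling_blocks_less[OF cw(2,1) _ _ below_refl] f
      by auto
  qed
qed

text \<open>By \<open>good\<close>, \<open>x\<close> lies on the same side of \<open>c\<close> as
  \<open>c\<close> does of \<open>p\<close>, so the block of \<open>x\<close> lies beyond
  \<open>c\<close> as seen from \<open>p\<close>.\<close>

lemma separates_edge_lower_block:
  assumes cx: "child p c" "child c x" and good: "g x < k"
    and f: "\<And>y. y \<in> f \<Longrightarrow> below x y"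
  shows "separates (layout n k g) {p, c} f"
proof (rule separates_layoutI)
  show "{p, c} \<subseteq> V" "f \<subseteq> V"
    using f below_in_V child_in_V cx by blast+
  have side: "side k g x = side k g c" using side_child[OF cx(2)] good by simp
  have "below c y" if "y \<in> f" for y
    using f[OF that] cx(2) unfolding below_def by (simp add: converse_rtranclp_into_rtranclp)
  then show "(\<forall>x\<in>{p, c}. \<forall>y\<in>f. pos n k g x < pos n k g y) \<or>
      (\<forall>x\<in>{p, c}. \<forall>y\<in>f. pos n k g y < pos n k g x)"
    using side_cases[of k g c] side pos_block_gt_parent[OF cx(1)] pos_block_lt_parent[OF cx(1)]
      pos_block_gt_parent[OF cx(2) f] pos_block_lt_parent[OF cx(2) f] by auto
qed

end

end

section \<open>Arbitrary pairs of nonincident edges\<close>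

lemma separates_sym: "separates r e f \<longleftrightarrow> separates r f e"
  unfolding separates_def by auto

definition rank_fun :: "nat \<Rightarrow> ('a \<Rightarrow> nat) \<Rightarrow> bool" where
  "rank_fun n g \<longleftrightarrow> inj_on g V \<and> (\<forall>v\<in>V. g v < n)"

text \<open>For each pair of nonincident edges only one of two kinds of events can prevent separation,
  and the vertices involved do not depend on the ranking.\<close>

lemma separates_layout_cases:
  assumes c: "child p c" and d: "child q d" and disj: "{p, c} \<inter> {q, d} = {}"
  obtains x where "x \<in> V"
      "\<And>g. rank_fun n g \<Longrightarrow> g x < k \<Longrightarrow> separates (layout n k g) {p, c} {q, d}"
  | x y where "x \<in> V" "y \<in> V" "x \<noteq> y"
      "\<And>g. rank_fun n g \<Longrightarrow> \<not> (g y < g x \<and> (g x < k \<longleftrightarrow> g y < k))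
        \<Longrightarrow> separates (layout n k g) {p, c} {q, d}"
proof -
  have lower: "\<exists>x\<in>V. \<forall>g. rank_fun n g \<longrightarrow> g x < k \<longrightarrow> separates (layout n k g) {p, c} {q, d}"
    if "child p c" "child q d" "{p, c} \<inter> {q, d} = {}" "below c d" for p c q d
  proof -
    from that obtain x where x: "child c x" "below x d"
      using below_cases_child[of c d] by auto
    \<comment> \<open>Otherwise \<open>q = c\<close>, against disjointness. Hence \<open>q\<close>
      too lies in the subtree of \<open>x\<close>.\<close>
    have "x \<noteq> d" using that x by (auto simp: child_def)
    then have "below x q" using below_par x that by blast
    then have f: "below x y" if "y \<in> {q, d}" for y using x that by auto
    have "separates (layout n k g) {p, c} {q, d}" if "rank_fun n g" "g x < k" for g
      using that f
      by (intro separates_edge_lower_block[OF _ _ \<open>child p c\<close> x(1)]) (auto simp: rank_fun_def)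
    then show ?thesis using x(1) by (auto simp: child_def)
  qed
  have sibling: "\<exists>x\<in>V. \<exists>y\<in>V. x \<noteq> y \<and> (\<forall>g. rank_fun n g \<longrightarrow>
      \<not> (g y < g x \<and> (g x < k \<longleftrightarrow> g y < k)) \<longrightarrow> separates (layout n k g) {p, c} {q, d})"
    if "child p c" "child p b" "c \<noteq> b" "below b q" "child q d" for p c q d b
  proof -
    have f: "below b y" if "y \<in> {q, d}" for y
      using below_child \<open>below b q\<close> \<open>child q d\<close> that by blast
    have "separates (layout n k g) {p, c} {q, d}"
      if "rank_fun n g" "\<not> (g b < g c \<and> (g c < k \<longleftrightarrow> g b < k))" for g
      using that f
      by (intro separates_edge_sibling_block[OF _ _ \<open>child p c\<close> \<open>child p b\<close> \<open>c \<noteq> b\<close>])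
        (auto simp: rank_fun_def)
    then show ?thesis using that by (metis child_def)
  qed
  have "c \<in> V" "d \<in> V" using c d by (auto simp: child_def)
  then show thesis
  proof (cases rule: below_trichotomy)
    case 1
    then show thesis using lower[OF c d disj] that(1) by blast
  next
    case 2
    have "{q, d} \<inter> {p, c} = {}" using disj by auto
    from lower[OF d c this 2] obtain x where x: "x \<in> V"
      "\<And>g. rank_fun n g \<Longrightarrow> g x < k \<Longrightarrow> separates (layout n k g) {q, d} {p, c}"
      by blast
    show thesis
      by (rule that(1)[OF x(1)]) (use x(2) separates_sym in blast)
  next
    case (3 m a b)
    \<comment> \<open>If \<open>a = c\<close>, the upper end \<open>p\<close> of the first edge is
      the branching point \<open>m\<close>; otherwise the whole first edge lies in the subtree of
      \<open>a\<close>. The same holds for \<open>b\<close>, \<open>d\<close> and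
      \<open>q\<close>.\<close>
    show thesis
    proof (cases "a = c")
      case True
      with 3 c have "m = p" by (simp add: child_def)
      moreover have "b \<noteq> d" using 3 c d disj True by (auto simp: child_def)
      ultimately have "child p b" "c \<noteq> b" "below b q"
        using 3 True below_par[OF 3(5) d] by auto
      from sibling[OF c this d] show thesis using that(2) by blast
    next
      case False
      then have p: "below a p" using below_par 3 c by blast
      show thesis
      proof (cases "b = d")
        case True
        with 3 d have "m = q" by (simp add: child_def)
        then have "child q a" "d \<noteq> a" using 3 True by auto
        from sibling[OF d this p c] obtain x y where xy: "x \<in> V" "y \<in> V" "x \<noteq> y"
          "\<And>g. rank_fun n g \<Longrightarrow> \<not> (g y < g x \<and> (g x < k \<longleftrightarrow> g y < k)) \<Longrightarrow>
            separates (layout n k g) {q, d} {p, c}"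
          by blast
        show thesis
          by (rule that(2)[OF xy(1-3)]) (use xy(4) separates_sym in blast)
      next
        case False
        then have q: "below b q" using below_par 3 d by blast
        \<comment> \<open>Here both edges lie inside sibling blocks and are separated under every
          ranking, so the first alternative holds with any vertex as \<open>x\<close>.\<close>
        have "separates (layout n k g) {p, c} {q, d}" if "rank_fun n g" for g
          using that p q 3
          by (intro separates_sibling_blocks[OF _ _ 3(1-3)]) (auto simp: rank_fun_def)
        then show thesis using that(1) \<open>c \<in> V\<close> by blast
      qed
    qed
  qed
qed

lemma fractional_separation_dim_less_sqrt2:
  assumes fin: "finite V" and E: "E \<subseteq> {{par v, v} | v. v \<in> V \<and> v \<noteq> root}"
  shows "fractional_separation_dim V E < ereal (sqrt 2)"
proof -
  obtain k n :: nat where kn: "card V \<le> n" "3 \<le> n" "k \<le> n" and pell: "2 * k\<^sup>2 = n\<^sup>2 + 1"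
    using Pell_solution_ge .
  obtain idx :: "'a \<Rightarrow> nat" where idx: "inj_on idx V" "idx ` V \<subseteq> {..<n}"
    using card_le_inj[of V "{..<n}"] fin kn by auto
  define P where "P = {\<sigma>. \<sigma> permutes {..<n}}"
  have finP: "finite P" and cardP: "card P = fact n"
    unfolding P_def by (auto simp: finite_permutations card_permutations)
  obtain \<sigma>s where \<sigma>s: "set \<sigma>s = P" "distinct \<sigma>s"
    using finite_distinct_list[OF finP] by blast
  define L where "L = map (\<lambda>\<sigma>. layout n k (\<sigma> \<circ> idx)) \<sigma>s"
  have len: "length L = fact n"
    unfolding L_def using \<sigma>s cardP distinct_card by fastforce
  have rank: "rank_fun n (\<sigma> \<circ> idx)" if "\<sigma> \<in> P" for \<sigma>
  proof -
    have \<sigma>: "\<sigma> permutes {..<n}" using that by (simp add: P_def)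
    then have "inj_on (\<sigma> \<circ> idx) V"
      using idx(1) by (metis comp_inj_on inj_on_subset permutes_inj subset_UNIV)
    then show ?thesis
      using idx(2) permutes_in_image[OF \<sigma>] by (auto simp: rank_fun_def)
  qed
  have many: "fact n < sqrt 2 * real (length (filter (\<lambda>r. separates r e f) L))"
    if ef: "e \<in> E" "f \<in> E" "nonincident e f" for e f
  proof -
    \<comment> \<open>Different permutations may give the same layout. The list keeps one entry per
      permutation, so filtering it counts permutations.\<close>
    have count: "card {\<sigma>\<in>P. Q \<sigma>} \<le> length (filter (\<lambda>r. separates r e f) L)"
      if "\<And>\<sigma>. \<sigma> \<in> P \<Longrightarrow> Q \<sigma> \<Longrightarrow> separates (layout n k (\<sigma> \<circ> idx)) e f" for Q
    proof -
      have "length (filter (\<lambda>r. separates r e f) L)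
          = card {\<sigma>\<in>P. separates (layout n k (\<sigma> \<circ> idx)) e f}"
        unfolding L_def filter_map length_map
        using distinct_card[OF distinct_filter[OF \<sigma>s(2)]] \<sigma>s(1) by (simp add: comp_def)
      then show ?thesis using that finP by (auto intro!: card_mono)
    qed
    have trans: ?thesis if "fact n < sqrt 2 * real m"
      "m \<le> length (filter (\<lambda>r. separates r e f) L)" for m
    proof -
      have "sqrt 2 * real m \<le> sqrt 2 * real (length (filter (\<lambda>r. separates r e f) L))"
        using that(2) by simp
      with that(1) show ?thesis by linarith
    qed
    have "\<exists>p c. e' = {p, c} \<and> child p c" if "e' \<in> E" for e'
      using subsetD[OF E that] by (auto simp: child_def)
    with ef obtain p c q d where e: "e = {p, c}" "child p c" and f: "f = {q, d}" "child q d"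
      by meson
    then have "{p, c} \<inter> {q, d} = {}" using ef by (simp add: nonincident_def)
    with e(2) f(2) show ?thesis
    proof (cases rule: separates_layout_cases[where n = n and k = k])
      case (1 x)
      have "idx x < n" using 1 idx by auto
      then have "fact n < sqrt 2 * real (card {\<sigma>\<in>P. \<sigma> (idx x) < k})"
        using card_permutes_below_gt[OF kn(3,2) pell] by (simp add: P_def)
      then show ?thesis
        by (rule trans) (rule count, use 1 e f rank in auto)
    next
      case (2 x y)
      have "idx x < n" "idx y < n" "idx x \<noteq> idx y" using 2 idx by (auto dest: inj_onD)
      then have "fact n < sqrt 2 * real (card {\<sigma>\<in>P. \<not> (\<sigma> (idx y) < \<sigma> (idx x) \<and>
          (\<sigma> (idx x) < k \<longleftrightarrow> \<sigma> (idx y) < k))})"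
        using card_permutes_not_same_side_inversion_gt[OF kn(3,2) pell] by (simp add: P_def)
      then show ?thesis
        by (rule trans) (rule count, use 2 e f rank in auto)
    qed
  qed
  \<comment> \<open>This is the least integer above \<open>fact n / sqrt 2\<close>. Every count
    exceeds that real number and so is at least \<open>t\<close>, and the bound
    \<open>fact n / t < sqrt 2\<close> stays strict.\<close>
  define t where "t = nat \<lfloor>fact n / sqrt 2 :: real\<rfloor> + 1"
  have t_gt: "fact n / sqrt 2 < real t"
    unfolding t_def by (simp add: of_nat_nat) linarith
  have "t_separating V E t L"
    unfolding t_separating_def
  proof (intro conjI ballI impI)
    fix r assume "r \<in> set L"
    then obtain \<sigma> where "r = layout n k (\<sigma> \<circ> idx)" "\<sigma> \<in> P"
      using \<sigma>s by (auto simp: L_def)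
    then show "linear_order_on V r"
      using linear_order_layout[of "\<sigma> \<circ> idx" n k] rank[of \<sigma>] by (auto simp: rank_fun_def)
  next
    fix e f assume "e \<in> E" "f \<in> E" "nonincident e f"
    from many[OF this] have "fact n / sqrt 2 < real (length (filter (\<lambda>r. separates r e f) L))"
      by (simp add: divide_less_eq mult.commute)
    then have "\<lfloor>fact n / sqrt 2 :: real\<rfloor> < int (length (filter (\<lambda>r. separates r e f) L))"
      by (simp add: floor_less_iff)
    moreover have "0 \<le> \<lfloor>fact n / sqrt 2 :: real\<rfloor>" by simp
    ultimately show "t \<le> length (filter (\<lambda>r. separates r e f) L)"
      unfolding t_def by linarith
  qed
  moreover have "t > 0" by (simp add: t_def)
  ultimately have "fractional_separation_dim V E \<le> ereal (fact n / real t)"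
    using fractional_separation_dim_le[of V E t L] by (simp add: len)
  also have "\<dots> < ereal (sqrt 2)"
    using t_gt \<open>t > 0\<close> by (simp add: divide_less_eq mult.commute)
  finally show ?thesis .
qed

end

section \<open>Rooting a tree\<close>

text \<open>Extend the path at its front; if the new vertex already occurs on it, discard everything
  before that occurrence.\<close>

lemma rtranclp_imp_distinct_path:
  assumes "R\<^sup>*\<^sup>* x y"
  obtains xs where "xs \<noteq> []" "hd xs = x" "last xs = y" "distinct xs" "successively R xs"
proof -
  from assms have "\<exists>xs. xs \<noteq> [] \<and> hd xs = x \<and> last xs = y \<and> distinct xs \<and> successively R xs"
  proof (induction rule: converse_rtranclp_induct)
    case base
    show ?case by (intro exI[of _ "[y]"]) simp
  next
    case (step x z)
    then obtain xs where xs: "xs \<noteq> []" "hd xs = z" "last xs = y" "distinct xs" "successively R xs"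
      by blast
    show ?case
    proof (cases "x \<in> set xs")
      case True
      then obtain us vs where "xs = us @ x # vs" by (meson split_list)
      with xs show ?thesis
        by (intro exI[of _ "x # vs"]) (auto simp: successively_append_iff)
    next
      case False
      with xs step show ?thesis
        by (intro exI[of _ "x # xs"]) (auto simp: successively_Cons)
    qed
  qed
  with that show ?thesis by blast
qed

lemma adjacent_commute: "adjacent E u v \<longleftrightarrow> adjacent E v u"
  by (simp add: adjacent_def insert_commute)

text \<open>An edge outside a connected spanning subgraph closes a cycle.\<close>

lemma acyclic_spanning_subgraph:
  assumes acyclic: "\<nexists>c. is_cycle E c" and simple: "finite_simple_graph V E"
    and F: "F \<subseteq> E" and conn: "\<And>u v. u \<in> V \<Longrightarrow> v \<in> V \<Longrightarrow> (adjacent F)\<^sup>*\<^sup>* u v"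
  shows "E \<subseteq> F"
proof (rule subsetI, rule ccontr)
  fix e assume e: "e \<in> E" "e \<notin> F"
  then have "card e = 2" "e \<subseteq> V" using simple by (auto simp: finite_simple_graph_def)
  then obtain x y where xy: "e = {x, y}" "x \<noteq> y" "x \<in> V" "y \<in> V"
    by (auto simp: card_2_iff)
  obtain c where c: "c \<noteq> []" "hd c = x" "last c = y" "distinct c" "successively (adjacent F) c"
    using rtranclp_imp_distinct_path[OF conn[OF xy(3,4)]] .
  \<comment> \<open>A path of one vertex would give \<open>x = y\<close>, and a path of two vertices
    would put \<open>e\<close> into \<open>F\<close>.\<close>
  have "length c \<ge> 3"
  proof (rule ccontr)
    assume "\<not> 3 \<le> length c"
    with c(1) consider a where "c = [a]" | a b where "c = [a, b]"
      by (cases c; cases "tl c"; cases "tl (tl c)") auto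
    then show False
      using c xy e by cases (auto simp: adjacent_def)
  qed
  moreover have "successively (adjacent E) c"
    using c(5) by (rule successively_mono) (use F in \<open>auto simp: adjacent_def\<close>)
  moreover have "adjacent E (last c) (hd c)"
    using c xy e by (simp add: adjacent_def insert_commute)
  ultimately have "is_cycle E c" using c(4) by (simp add: is_cycle_def)
  with acyclic show False by blast
qed

text \<open>Take distances from an arbitrary root as depths and a neighbour one step closer as
  parent. The parent edges already connect \<open>V\<close>, so acyclicity leaves no room for
  further edges.\<close>

lemma is_tree_rooted:
  assumes "is_tree V E"
  obtains root par depth where "rooted_tree V root par depth"
    "E \<subseteq> {{par v, v} | v. v \<in> V \<and> v \<noteq> root}"
proof -
  have simple: "finite_simple_graph V E" and acyclic: "\<nexists>c. is_cycle E c"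
    and conn: "connected_graph V E"
    using assms by (auto simp: is_tree_def)
  have adj_V: "adjacent E u v \<Longrightarrow> u \<in> V \<and> v \<in> V" for u v
    using simple by (auto simp: finite_simple_graph_def adjacent_def)
  obtain root where root: "root \<in> V"
    using conn by (auto simp: connected_graph_def)
  define depth where "depth v = (LEAST m. (adjacent E ^^ m) root v)" for v
  have reach: "(adjacent E ^^ depth v) root v" if "v \<in> V" for v
  proof -
    have "(adjacent E)\<^sup>*\<^sup>* root v" using conn root that by (auto simp: connected_graph_def)
    then show ?thesis unfolding depth_def by (metis LeastI rtranclp_imp_relpowp)
  qed
  have depth_le: "depth v \<le> m" if "(adjacent E ^^ m) root v" for v m
    unfolding depth_def using that by (rule Least_le)
  have "\<exists>p. adjacent E p v \<and> depth v = Suc (depth p)" if v: "v \<in> V" "v \<noteq> root" for v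
  proof (cases "depth v")
    case 0
    with reach[OF v(1)] v show ?thesis by simp
  next
    case (Suc m)
    with reach[OF v(1)] obtain p where p: "(adjacent E ^^ m) root p" "adjacent E p v" by auto
    \<comment> \<open>The predecessor \<open>p\<close> on a shortest walk is reached in
      \<open>m\<close> steps, so its depth is at most \<open>m\<close>; this inequality gives the
      converse bound.\<close>
    then have "depth v \<le> Suc (depth p)"
      using depth_le[of "Suc (depth p)" v] reach[of p] adj_V by auto
    with p Suc depth_le[OF p(1)] show ?thesis by auto
  qed
  then obtain par where par: "\<And>v. v \<in> V \<Longrightarrow> v \<noteq> root \<Longrightarrow> adjacent E (par v) v \<and> depth v = Suc (depth (par v))"
    by metis
  have tree: "rooted_tree V root par depth"
  proof
    show "depth root = 0" using depth_le[of 0 root] by simp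
  qed (use root par adj_V in blast)+
  define F where "F = {{par v, v} | v. v \<in> V \<and> v \<noteq> root}"
  have "symp (adjacent F)" by (simp add: symp_def adjacent_commute)
  then have sym: "(adjacent F)\<^sup>*\<^sup>* u v \<Longrightarrow> (adjacent F)\<^sup>*\<^sup>* v u" for u v
    by (metis symp_rtranclp sympD)
  have from_root: "(adjacent F)\<^sup>*\<^sup>* root v" if "v \<in> V" for v
  proof -
    have "rooted_tree.child V root par \<le> adjacent F"
      by (auto simp: rooted_tree.child_def[OF tree] adjacent_def F_def)
    then show ?thesis
      using rooted_tree.below_root[OF tree that] rtranclp_mono
      unfolding rooted_tree.below_def[OF tree] by blast
  qed
  have "E \<subseteq> F"
  proof (rule acyclic_spanning_subgraph[OF acyclic simple])
    show "F \<subseteq> E" using par by (auto simp: F_def adjacent_def)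
    show "(adjacent F)\<^sup>*\<^sup>* u v" if "u \<in> V" "v \<in> V" for u v
      using sym[OF from_root[OF that(1)]] from_root[OF that(2)] by simp
  qed
  with tree show ?thesis unfolding F_def by (rule that)
qed

theorem mainTheorem7:
  fixes V :: "'a set" and E :: "'a set set"
  assumes "is_tree V E"
  shows "fractional_separation_dim V E < ereal (sqrt 2)"
proof -
  obtain root par depth where "rooted_tree V root par depth"
    "E \<subseteq> {{par v, v} | v. v \<in> V \<and> v \<noteq> root}"
    using is_tree_rooted[OF assms] .
  moreover have "finite V" using assms by (simp add: is_tree_def finite_simple_graph_def)
  ultimately show ?thesis by (intro rooted_tree.fractional_separation_dim_less_sqrt2)
qed

end
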